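(* Let $k,r\ge 2$ be integers and let $\Gamma$ be the symmetric graph of type $k$ and order $r$, with vertex set $\mathcal V$ and origin $o$. Let $f$ be a finitely supported radial function on $\mathcal V$ and $n\in\mathbb N$. Then $$\operatorname{supp} f\subset B'(o,n)\quad\text{if and only if}\quad \operatorname{supp}\mathcal A f\subset[-n,n],$$ where $B'(o,n)=\{x\in\mathcal V: |x|\le n\}$.
   Context: Symmetric graph: $\Gamma$ is a connected graph in which every vertex $v$ belongs to exactly $r$ polygons with $k$ sides each (for $k=2$ a polygon is a single edge), these polygons having no side and no vertex in common except $v$, and such that every nontrivial loop runs through all the edges of at least one polygon. $\mathcal V$ is its vertex set. The distance $d(x,y)$ is the minimal number of polygons crossed by a path connecting $x$ with $y$. Fix an origin $o\in\mathcal V$ and put $|x|=d(x,o)$, $Q=(r-1)(k-1)$. Boundary: $\Omega$ is the set of geodesic rays starting at $o$; a ray $\omega$ is identified with its sequence of nodes $\omega_0=o,\omega_1,\omega_2,\dots$ in $\mathcal V$, with $d(\omega_i,\omega_j)=|i-j|$. The Busemann function is $\zeta(x,\omega)=d(o,\omega_m)-d(x,\omega_m)$ for $m>|x|$ (independent of such $m$), and the horocycles are $H_h(\omega)=\{x\in\mathcal V:\zeta(x,\omega)=h\}$ for $h\in\mathbb Z$. A function on $\mathcal V$ is radial if it depends only on $|x|$. Abel transform: for $f$ radial and finitely supported and $h\in\mathbb Z$, $\mathcal A f(h)=Q^{h/2}\sum_{x\in H_h(\omega)}f(x)$, which is independent of $\omega\in\Omega$. *)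

theory Defs
  imports "HOL-Analysis.Analysis"
begin

section \<open>Walks, polygons and loops in a simple graph\<close>

text \<open>A graph is given by a vertex set \<open>V\<close> and a set \<open>E\<close> of two-element edges.\<close>

definition walk :: "'v set \<Rightarrow> 'v set set \<Rightarrow> 'v list \<Rightarrow> bool" where
  "walk V E w \<longleftrightarrow> w \<noteq> [] \<and> set w \<subseteq> V \<and> successively (\<lambda>x y. {x, y} \<in> E) w"

definition walk_edges :: "'v list \<Rightarrow> 'v set set" where
  "walk_edges w = {{w ! i, w ! Suc i} | i. Suc i < length w}"

text \<open>A polygon is represented by its set of sides, so its vertex set is \<open>\<Union>P\<close>. For \<open>k = 2\<close>
  the closed walk is \<open>[a, b, a]\<close> and the polygon is the single edge \<open>{{a, b}}\<close>.\<close>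

definition polygons :: "'v set \<Rightarrow> 'v set set \<Rightarrow> nat \<Rightarrow> 'v set set set" where
  "polygons V E k =
     {walk_edges (c @ [hd c]) | c. length c = k \<and> distinct c \<and> walk V E (c @ [hd c])}"

text \<open>Loops up to insertion and deletion of backtracking steps are represented by their reduced
  forms. Reduction only discards edges, so it is enough to consider reduced loops when
  asking that every loop that is not contractible contains certain edges.\<close>

definition nontrivial_loop :: "'v set \<Rightarrow> 'v set set \<Rightarrow> 'v list \<Rightarrow> bool" where
  "nontrivial_loop V E w \<longleftrightarrow> walk V E w \<and> 1 < length w \<and> hd w = last w \<and>
     (\<forall>i. i + 2 < length w \<longrightarrow> w ! i \<noteq> w ! (i + 2))"


section \<open>Symmetric graphs\<close>

text \<open>Two points are left implicit in the usual wording of the definition.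
  The graph consists of its polygons (\<open>edge_in_polygon\<close>); otherwise bridges could be added
  freely when \<open>k \<ge> 3\<close>. For \<open>k = 2\<close> the graph is the homogeneous tree of degree \<open>r\<close>:
  going around a polygon with two sides means going back and forth along an edge, which
  a nontrivial loop need not do, so there is no nontrivial loop at all. Hence the
  conjunct \<open>2 < k\<close> in \<open>loops\<close>, without which that axiom would be void for \<open>k = 2\<close>.\<close>

locale symmetric_graph =
  fixes V :: "'v set" and E :: "'v set set" and k r :: nat
  assumes edges: "e \<in> E \<Longrightarrow> e \<subseteq> V \<and> card e = 2"
    and connected: "x \<in> V \<Longrightarrow> y \<in> V \<Longrightarrow> \<exists>w. walk V E w \<and> hd w = x \<and> last w = y"
    and edge_in_polygon: "e \<in> E \<Longrightarrow> \<exists>P\<in>polygons V E k. e \<in> P"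
    and polygons_at: "v \<in> V \<Longrightarrow> card {P \<in> polygons V E k. v \<in> \<Union>P} = r"
    and polygons_meet: "\<lbrakk>P \<in> polygons V E k; P' \<in> polygons V E k; P \<noteq> P'; v \<in> \<Union>P; v \<in> \<Union>P'\<rbrakk>
          \<Longrightarrow> P \<inter> P' = {} \<and> \<Union>P \<inter> \<Union>P' = {v}"
    and loops: "nontrivial_loop V E w
          \<Longrightarrow> 2 < k \<and> (\<exists>P\<in>polygons V E k. P \<subseteq> walk_edges w)"

text \<open>A walk crosses a polygon if it uses at least one of its sides.\<close>

definition polygon_dist :: "'v set \<Rightarrow> 'v set set \<Rightarrow> nat \<Rightarrow> 'v \<Rightarrow> 'v \<Rightarrow> nat" where
  "polygon_dist V E k x y =
     (LEAST n. \<exists>w. walk V E w \<and> hd w = x \<and> last w = y \<and>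
        n = card {P \<in> polygons V E k. P \<inter> walk_edges w \<noteq> {}})"

definition radial :: "'v set \<Rightarrow> 'v set set \<Rightarrow> nat \<Rightarrow> 'v \<Rightarrow> ('v \<Rightarrow> complex) \<Rightarrow> bool" where
  "radial V E k x0 f \<longleftrightarrow>
     (\<forall>x\<in>V. \<forall>y\<in>V. polygon_dist V E k x x0 = polygon_dist V E k y x0 \<longrightarrow> f x = f y)"


section \<open>Boundary, horocycles and the Abel transform\<close>

definition boundary :: "'v set \<Rightarrow> 'v set set \<Rightarrow> nat \<Rightarrow> 'v \<Rightarrow> (nat \<Rightarrow> 'v) set" where
  "boundary V E k x0 = {\<omega>. \<omega> 0 = x0 \<and> range \<omega> \<subseteq> V \<and>
     (\<forall>i j. int (polygon_dist V E k (\<omega> i) (\<omega> j)) = \<bar>int i - int j\<bar>)}"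

text \<open>The difference of distances does not depend on \<open>m\<close> once \<open>m\<close> exceeds the distance of \<open>x\<close>
  from the origin; the smallest such \<open>m\<close> is used.\<close>

definition busemann :: "'v set \<Rightarrow> 'v set set \<Rightarrow> nat \<Rightarrow> 'v \<Rightarrow> 'v \<Rightarrow> (nat \<Rightarrow> 'v) \<Rightarrow> int" where
  "busemann V E k x0 x \<omega> =
     (let m = Suc (polygon_dist V E k x x0)
      in int (polygon_dist V E k x0 (\<omega> m)) - int (polygon_dist V E k x (\<omega> m)))"

definition horocycle :: "'v set \<Rightarrow> 'v set set \<Rightarrow> nat \<Rightarrow> 'v \<Rightarrow> (nat \<Rightarrow> 'v) \<Rightarrow> int \<Rightarrow> 'v set" where
  "horocycle V E k x0 \<omega> h = {x \<in> V. busemann V E k x0 x \<omega> = h}"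

text \<open>Horocycles are infinite in general, hence \<open>infsum\<close>; for finitely supported \<open>f\<close> it is the
  finite sum over the support. For radial \<open>f\<close> the value does not depend on \<open>\<omega>\<close>;
  the ray is kept as a parameter.\<close>

definition abel_transform ::
  "'v set \<Rightarrow> 'v set set \<Rightarrow> nat \<Rightarrow> nat \<Rightarrow> 'v \<Rightarrow> (nat \<Rightarrow> 'v) \<Rightarrow> ('v \<Rightarrow> complex) \<Rightarrow> int \<Rightarrow> complex" where
  "abel_transform V E k r x0 \<omega> f h =
     complex_of_real (((real r - 1) * (real k - 1)) powr (real_of_int h / 2)) *
     (\<Sum>\<^sub>\<infinity>x\<in>horocycle V E k x0 \<omega> h. f x)"

end

(*
  By the triangle inequality the Busemann function is bounded by |x|, which gives one implication.
  For the other one, let N be the largest value of |x| on the support of f.  The points of the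
  horocycle of index N satisfy |x| >= N, so those in the support lie on the sphere of radius N,
  where the radial function f is a nonzero constant c; the point omega_N is one of them.  Hence
  A f(N) is a positive multiple of c, so A f(N) does not vanish.
*)
theory Submission
  imports Defs
begin

lemma walk_edges_simps [simp]:
  "walk_edges [] = {}"
  "walk_edges [x] = {}"
  "walk_edges (x # y # xs) = insert {x, y} (walk_edges (y # xs))"
proof -
  show "walk_edges (x # y # xs) = insert {x, y} (walk_edges (y # xs))"
  proof (intro equalityI subsetI)
    fix e assume "e \<in> walk_edges (x # y # xs)"
    then obtain i where "Suc i < length (x # y # xs)"
      and "e = {(x # y # xs) ! i, (x # y # xs) ! Suc i}"
      unfolding walk_edges_def by blast
    then show "e \<in> insert {x, y} (walk_edges (y # xs))"
      by (cases i) (auto simp: walk_edges_def)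
  next
    fix e assume "e \<in> insert {x, y} (walk_edges (y # xs))"
    then consider "e = {x, y}"
      | i where "Suc i < length (y # xs)" "e = {(y # xs) ! i, (y # xs) ! Suc i}"
      unfolding walk_edges_def by blast
    then show "e \<in> walk_edges (x # y # xs)"
    proof cases
      case 1
      then show ?thesis unfolding walk_edges_def by (auto intro!: exI[of _ 0])
    next
      case (2 i)
      then show ?thesis unfolding walk_edges_def by (auto intro!: exI[of _ "Suc i"])
    qed
  qed
qed (auto simp: walk_edges_def)

text \<open>The junction \<open>v\<close> is kept in both pieces so that each edge at
  \<open>v\<close> falls into one of them. This is what splits the polygons crossed by a
  concatenated walk.\<close>

lemma walk_edges_append:
  "walk_edges (xs @ v # ys) = walk_edges (xs @ [v]) \<union> walk_edges (v # ys)"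
proof (induction xs rule: induct_list012)
  case 1
  then show ?case by simp
next
  case (2 x)
  then show ?case by simp
next
  case (3 x y zs)
  then show ?case by simp
qed

lemma walk_edges_rev: "walk_edges (rev w) = walk_edges w"
proof (induction w rule: induct_list012)
  case (3 x y xs)
  \<comment> \<open>The reversed list is \<open>rev xs @ y # [x]\<close>, which is split at
    \<open>y\<close>.\<close>
  then show ?case
    using walk_edges_append[of "rev xs" y "[x]"] by (auto simp: insert_commute)
qed auto

lemma walk_rev: "walk V E (rev w) \<longleftrightarrow> walk V E w"
proof -
  have "(\<lambda>x y. {y, x} \<in> E) = (\<lambda>x y. {x, y} \<in> E)"
    by (intro ext) (simp only: insert_commute)
  then show ?thesis unfolding walk_def by (simp only: successively_rev set_rev rev_is_Nil_conv)
qed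

lemma walk_append:
  assumes "walk V E (xs @ [v])" and "walk V E (v # ys)"
  shows "walk V E (xs @ v # ys)"
  using assms by (auto simp: walk_def successively_append_iff)

text \<open>Reversing a walk swaps its ends and keeps its edges, hence the polygons it
  crosses.\<close>

lemma polygon_dist_commute: "polygon_dist V E k x y = polygon_dist V E k y x"
proof -
  have *: "\<exists>w'. walk V E w' \<and> hd w' = b \<and> last w' = a \<and>
      m = card {P \<in> polygons V E k. P \<inter> walk_edges w' \<noteq> {}}"
    if "\<exists>w. walk V E w \<and> hd w = a \<and> last w = b \<and>
      m = card {P \<in> polygons V E k. P \<inter> walk_edges w \<noteq> {}}" for a b m
  proof -
    from that obtain w where "walk V E w" "hd w = a" "last w = b"
      "m = card {P \<in> polygons V E k. P \<inter> walk_edges w \<noteq> {}}" by blast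
    then show ?thesis
      by (intro exI[of _ "rev w"]) (simp add: walk_rev walk_edges_rev hd_rev last_rev)
  qed
  show ?thesis
    unfolding polygon_dist_def by (intro arg_cong[where f = Least] ext iffI; rule *)
qed

context symmetric_graph
begin

text \<open>Connectedness makes the set under \<open>LEAST\<close> nonempty, so the minimum is
  attained.\<close>

lemma polygon_dist_walk:
  assumes "x \<in> V" "y \<in> V"
  obtains w where "walk V E w" "hd w = x" "last w = y"
    "polygon_dist V E k x y = card {P \<in> polygons V E k. P \<inter> walk_edges w \<noteq> {}}"
proof -
  have "\<exists>m w. walk V E w \<and> hd w = x \<and> last w = y \<and>
      m = card {P \<in> polygons V E k. P \<inter> walk_edges w \<noteq> {}}"
    using connected[OF assms] by blast
  from LeastI_ex[OF this] show thesis
    unfolding polygon_dist_def[symmetric] using that by blast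
qed

text \<open>Join two minimal walks at \<open>y\<close>: a polygon crossed by the result is crossed
  by one of the two.\<close>

lemma polygon_dist_triangle:
  assumes "x \<in> V" "y \<in> V" "z \<in> V"
  shows "polygon_dist V E k x z \<le> polygon_dist V E k x y + polygon_dist V E k y z"
proof -
  let ?C = "\<lambda>w. {P \<in> polygons V E k. P \<inter> walk_edges w \<noteq> {}}"
  obtain u where u: "walk V E u" "hd u = x" "last u = y"
    "polygon_dist V E k x y = card (?C u)"
    using polygon_dist_walk[OF assms(1,2)] .
  obtain w where w: "walk V E w" "hd w = y" "last w = z"
    "polygon_dist V E k y z = card (?C w)"
    using polygon_dist_walk[OF assms(2,3)] .
  have "u \<noteq> []" using u(1) by (simp add: walk_def)
  with u(3) obtain u' where u': "u = u' @ [y]"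
    by (cases u rule: rev_cases) auto
  obtain w' where w': "w = y # w'"
    using w by (cases w) (auto simp: walk_def)
  have walk: "walk V E (u' @ y # w')"
    using walk_append[of V E u' y w'] u(1) w(1) u' w' by simp
  have hd: "hd (u' @ y # w') = x"
    using u(2) u' by (cases u') auto
  have last: "last (u' @ y # w') = z"
    using w(3) w' by simp
  have "polygon_dist V E k x z \<le> card (?C (u' @ y # w'))"
    unfolding polygon_dist_def by (rule Least_le) (use walk hd last in blast)
  also have "?C (u' @ y # w') = ?C u \<union> ?C w"
    unfolding u' w' walk_edges_append[of u' y w'] by blast
  \<comment> \<open>This also holds for infinite sets, whose \<open>card\<close> is 0, so the
    crossed polygons need not be shown to be finite in number.\<close>
  also have "card (?C u \<union> ?C w) \<le> card (?C u) + card (?C w)"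
    by (rule card_Un_le)
  finally show ?thesis using u(4) w(4) by simp
qed

lemma abs_busemann_le:
  assumes "\<omega> \<in> boundary V E k x0" "x \<in> V" "x0 \<in> V"
  shows "\<bar>busemann V E k x0 x \<omega>\<bar> \<le> int (polygon_dist V E k x x0)"
proof -
  define m where "m = Suc (polygon_dist V E k x x0)"
  have m: "\<omega> m \<in> V" using assms(1) by (auto simp: boundary_def)
  show ?thesis
    \<comment> \<open>The two instances, through \<open>x0\<close> and through \<open>x\<close>,
      bound the difference from below and from above.\<close>
    using polygon_dist_triangle[OF assms(2,3) m] polygon_dist_triangle[OF assms(3,2) m]
    by (simp add: busemann_def m_def[symmetric] Let_def polygon_dist_commute[of V E k x0 x])
qed

end

lemma polygon_dist_boundary:
  assumes "\<omega> \<in> boundary V E k x0"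
  shows "polygon_dist V E k (\<omega> i) x0 = i"
proof -
  have "int (polygon_dist V E k (\<omega> i) (\<omega> 0)) = \<bar>int i - int 0\<bar>" and "\<omega> 0 = x0"
    using assms unfolding boundary_def by blast+
  then show ?thesis by simp
qed

text \<open>At \<open>\<omega> i\<close> the definition takes \<open>m = i + 1\<close>, and the
  difference is \<open>(i + 1) - 1\<close>. Thus every horocycle of index \<open>i\<close> meets the
  ray, which provides the point where the transform is shown not to vanish.\<close>

lemma busemann_boundary:
  assumes "\<omega> \<in> boundary V E k x0"
  shows "busemann V E k x0 (\<omega> i) \<omega> = int i"
proof -
  have "int (polygon_dist V E k (\<omega> i) (\<omega> (Suc i))) = \<bar>int i - int (Suc i)\<bar>"
    using assms unfolding boundary_def by blast
  then show ?thesis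
    by (simp add: busemann_def polygon_dist_boundary[OF assms]
        polygon_dist_commute[of V E k x0 "\<omega> (Suc i)"])
qed

theorem corollary3p4:
  fixes V :: "'v set" and E :: "'v set set" and k r n :: nat
    and x0 :: 'v and \<omega> :: "nat \<Rightarrow> 'v" and f :: "'v \<Rightarrow> complex"
  assumes "k \<ge> 2" and "r \<ge> 2"
    and "symmetric_graph V E k r"
    and "x0 \<in> V"
    and "\<omega> \<in> boundary V E k x0"
    and "radial V E k x0 f"
    and "finite {x \<in> V. f x \<noteq> 0}"
  shows "{x \<in> V. f x \<noteq> 0} \<subseteq> {x \<in> V. polygon_dist V E k x x0 \<le> n} \<longleftrightarrow>
         {h. abel_transform V E k r x0 \<omega> f h \<noteq> 0} \<subseteq> {- int n..int n}"
proof -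
  interpret symmetric_graph V E k r by fact
  let ?d = "\<lambda>x. polygon_dist V E k x x0"
  let ?H = "horocycle V E k x0 \<omega>"
  let ?A = "abel_transform V E k r x0 \<omega> f"
  have le: "\<bar>h\<bar> \<le> int (?d x)" if "x \<in> ?H h" for x h
    using abs_busemann_le[OF assms(5) _ assms(4), of x] that by (simp add: horocycle_def)
  show ?thesis
  proof
    assume supp: "{x \<in> V. f x \<noteq> 0} \<subseteq> {x \<in> V. ?d x \<le> n}"
    show "{h. ?A h \<noteq> 0} \<subseteq> {- int n..int n}"
    proof
      fix h assume "h \<in> {h. ?A h \<noteq> 0}"
      then have "infsum f (?H h) \<noteq> 0" by (simp add: abel_transform_def)
      \<comment> \<open>Contrapositive of \<open>infsum_0\<close>: a function that vanishes on the
        whole horocycle has sum 0.\<close>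
      then obtain x where x: "x \<in> ?H h" "f x \<noteq> 0" by (meson infsum_0)
      then have "?d x \<le> n" using supp by (auto simp: horocycle_def)
      with le[OF x(1)] show "h \<in> {- int n..int n}" by auto
    qed
  next
    assume supp: "{h. ?A h \<noteq> 0} \<subseteq> {- int n..int n}"
    show "{x \<in> V. f x \<noteq> 0} \<subseteq> {x \<in> V. ?d x \<le> n}"
    \<comment> \<open>The zero function is set apart because \<open>Max\<close> is meaningful only
      on a nonempty set.\<close>
    proof (cases "{x \<in> V. f x \<noteq> 0} = {}")
      case False
      define N where "N = Max (?d ` {x \<in> V. f x \<noteq> 0})"
      have N_ge: "?d x \<le> N" if "x \<in> V" "f x \<noteq> 0" for x
        unfolding N_def using assms(7) that by (intro Max_ge) auto
      have "N \<in> ?d ` {x \<in> V. f x \<noteq> 0}"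
        unfolding N_def using assms(7) False by (intro Max_in) auto
      then obtain y where y: "y \<in> V" "f y \<noteq> 0" "?d y = N" by blast
      define S where "S = {x \<in> ?H (int N). f x \<noteq> 0}"
      have const: "f x = f y" if "x \<in> V" "?d x = N" for x
        using assms(6) that(1) y(1) trans[OF that(2) y(3)[symmetric]]
        unfolding radial_def by blast
      have fS: "f x = f y" if "x \<in> S" for x
      proof (rule const)
        show "x \<in> V" using that by (simp add: S_def horocycle_def)
        with that N_ge[of x] le[of x "int N"] show "?d x = N" by (simp add: S_def)
      qed
      have \<omega>N: "\<omega> N \<in> V" using assms(5) by (auto simp: boundary_def)
      have "f (\<omega> N) = f y"
        using const[OF \<omega>N polygon_dist_boundary[OF assms(5)]] .
      then have "\<omega> N \<in> S"
        using \<omega>N y by (simp add: S_def horocycle_def busemann_boundary[OF assms(5)])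
      moreover have finS: "finite S"
        by (rule finite_subset[OF _ assms(7)]) (auto simp: S_def horocycle_def)
      ultimately have card: "card S \<noteq> 0" by auto
      \<comment> \<open>The horocycle may be infinite, but \<open>f\<close> vanishes on it outside
        the finite set \<open>S\<close>; all terms left equal \<open>f y\<close>, so nothing can
        cancel.\<close>
      have "infsum f (?H (int N)) = infsum f S"
        by (rule infsum_cong_neutral) (auto simp: S_def)
      also have "\<dots> = of_nat (card S) * f y"
        using finS fS by simp
      finally have "infsum f (?H (int N)) \<noteq> 0" using card y by simp
      \<comment> \<open>The base Q is at least 1 since \<open>k\<close> and \<open>r\<close> are at
        least 2; \<open>powr\<close> with base 0 would give 0.\<close>
      moreover have "((real r - 1) * (real k - 1)) powr (real_of_int (int N) / 2) \<noteq> 0"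
        using assms(1,2) by auto
      ultimately have "?A (int N) \<noteq> 0" by (simp add: abel_transform_def)
      then have "N \<le> n" using supp by auto
      then show ?thesis using N_ge by force
    qed blast
  qed
qed

end
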